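(* Let $\lambda\le\kappa$ be cardinals and let $U$ be a $\lambda$-complete filter over $\kappa$. Then $(U,\supseteq)\ge_T([\kappa]^{<\lambda},\subseteq)$ if and only if $\neg\mathrm{Gal}(U,\lambda,\kappa)$. In particular, if $\kappa$ is a measurable cardinal, then the $\kappa$-complete ultrafilters $U$ over $\kappa$ which are Tukey-top are exactly those for which $\neg\mathrm{Gal}(U,\kappa,2^\kappa)$ holds.
   Context: For directed posets $(P,\le_P)$, $(Q,\le_Q)$, $P\le_T Q$ (Tukey reducibility) means there is a map $g:P\to Q$ such that the image of every unbounded subset of $P$ is unbounded in $Q$ (equivalently, a map $f:Q\to P$ sending cofinal subsets of $Q$ to cofinal subsets of $P$); $P\equiv_T Q$ means $P\le_T Q$ and $Q\le_T P$. Filters are ordered by reverse inclusion $\supseteq$. For $[X]^{<\lambda}$ the set of subsets of $X$ of cardinality $<\lambda$. For a filter $U$ over $\kappa$ and cardinals $\mu\le\nu$, $\mathrm{Gal}(U,\mu,\nu)$ means: for every sequence $\langle A_i\mid i<\nu\rangle$ of (distinct) members of $U$ there is $I\subseteq\nu$ with $|I|=\mu$ such that $\bigcap_{i\in I}A_i\in U$. A $\kappa$-complete ultrafilter $U$ over $\kappa$ is Tukey-top if $(U,\supseteq)\equiv_T([2^\kappa]^{<\kappa},\subseteq)$. Ultrafilters are assumed uniform (every member has size $\kappa$).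
   Formalization: The cardinal λ is assumed infinite: for λ=1 the equivalence fails (both the Tukey reduction and Gal(U,1,κ) hold trivially), and for other finite λ≤κ the set [κ]^{<λ} is not a (nonempty) directed poset. *)

theory Defs
  imports Main
begin

unbundle cardinal_syntax

text \<open>
  Cardinals are cardinal orders in the sense of \<^const>\<open>Card_order\<close>; the underlying set of a
  cardinal \<open>\<kappa>\<close> is \<open>Field \<kappa>\<close>.  A poset is given by its carrier and its order relation.
\<close>

definition unbounded_in :: "'a set \<Rightarrow> ('a \<Rightarrow> 'a \<Rightarrow> bool) \<Rightarrow> 'a set \<Rightarrow> bool" where
  "unbounded_in P le S \<longleftrightarrow> S \<subseteq> P \<and> \<not> (\<exists>b\<in>P. \<forall>x\<in>S. le x b)"

definition tukey_le ::
  "'a set \<Rightarrow> ('a \<Rightarrow> 'a \<Rightarrow> bool) \<Rightarrow> 'b set \<Rightarrow> ('b \<Rightarrow> 'b \<Rightarrow> bool) \<Rightarrow> bool" where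
  "tukey_le P leP Q leQ \<longleftrightarrow>
     (\<exists>g. g ` P \<subseteq> Q \<and> (\<forall>S. unbounded_in P leP S \<longrightarrow> unbounded_in Q leQ (g ` S)))"

definition tukey_equiv ::
  "'a set \<Rightarrow> ('a \<Rightarrow> 'a \<Rightarrow> bool) \<Rightarrow> 'b set \<Rightarrow> ('b \<Rightarrow> 'b \<Rightarrow> bool) \<Rightarrow> bool" where
  "tukey_equiv P leP Q leQ \<longleftrightarrow> tukey_le P leP Q leQ \<and> tukey_le Q leQ P leP"

definition subsets_below :: "'a set \<Rightarrow> 'l rel \<Rightarrow> 'a set set" where
  "subsets_below X \<mu> = {A. A \<subseteq> X \<and> |A| <o \<mu>}"

definition filter_over :: "'a set \<Rightarrow> 'a set set \<Rightarrow> bool" where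
  "filter_over X U \<longleftrightarrow>
     U \<subseteq> Pow X \<and> X \<in> U \<and> {} \<notin> U \<and>
     (\<forall>A\<in>U. \<forall>B\<in>U. A \<inter> B \<in> U) \<and>
     (\<forall>A\<in>U. \<forall>B. A \<subseteq> B \<and> B \<subseteq> X \<longrightarrow> B \<in> U)"

definition complete_family :: "'l rel \<Rightarrow> 'a set set \<Rightarrow> bool" where
  "complete_family \<mu> U \<longleftrightarrow> (\<forall>F. F \<subseteq> U \<and> F \<noteq> {} \<and> |F| <o \<mu> \<longrightarrow> \<Inter>F \<in> U)"

definition ultrafilter_over :: "'a set \<Rightarrow> 'a set set \<Rightarrow> bool" where
  "ultrafilter_over X U \<longleftrightarrow> filter_over X U \<and> (\<forall>A. A \<subseteq> X \<longrightarrow> A \<in> U \<or> X - A \<in> U)"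

definition principal_over :: "'a set \<Rightarrow> 'a set set \<Rightarrow> bool" where
  "principal_over X U \<longleftrightarrow> (\<exists>x\<in>X. U = {A. A \<subseteq> X \<and> x \<in> A})"

definition uniform_over :: "'k rel \<Rightarrow> 'k set set \<Rightarrow> bool" where
  "uniform_over \<kappa> U \<longleftrightarrow> (\<forall>A\<in>U. |A| =o \<kappa>)"

definition measurable_cardinal :: "'k rel \<Rightarrow> bool" where
  "measurable_cardinal \<kappa> \<longleftrightarrow>
     Card_order \<kappa> \<and> natLeq <o \<kappa> \<and>
     (\<exists>U. ultrafilter_over (Field \<kappa>) U \<and> \<not> principal_over (Field \<kappa>) U \<and> complete_family \<kappa> U)"

text \<open>
  Only used for infinite \<open>\<mu>\<close>, so that the index set \<open>I\<close> is nonempty and the intersection is not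
  the whole type by default.
\<close>
definition Gal :: "'a set set \<Rightarrow> 'm rel \<Rightarrow> 'n rel \<Rightarrow> bool" where
  "Gal U \<mu> \<nu> \<longleftrightarrow>
     (\<forall>A. A ` Field \<nu> \<subseteq> U \<and> inj_on A (Field \<nu>) \<longrightarrow>
        (\<exists>I. I \<subseteq> Field \<nu> \<and> |I| =o \<mu> \<and> (\<Inter>i\<in>I. A i) \<in> U))"

definition tukey_top :: "'k rel \<Rightarrow> 'k set set \<Rightarrow> bool" where
  "tukey_top \<kappa> U \<longleftrightarrow>
     tukey_equiv U (\<supseteq>) (subsets_below (Field (ctwo ^c \<kappa>)) \<kappa>) (\<subseteq>)"

end

theory Submission
  imports Defs
begin

text \<open>
  If no \<open>\<mu>\<close> many of the \<open>A i\<close> have their intersection in \<open>U\<close>, then \<open>S \<mapsto> \<Inter>i\<in>S. A i\<close> is a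
  Tukey map, because a family in \<open>[\<nu>]\<^bsup><\<mu>\<^esup>\<close> is unbounded iff its union has size at least \<open>\<mu>\<close>.
  Conversely, a Tukey map \<open>g\<close> yields the family \<open>i \<mapsto> g {i}\<close>, which witnesses the failure of the
  Galvin property except that it may fail to be injective.  Its fibres have size less than \<open>\<mu>\<close>,
  and by \<open>\<mu>\<close>-completeness its range has size at least \<open>\<mu>\<close>; hence the range has size \<open>\<nu>\<close>, and the
  family can be thinned out to an injective one.  This argument needs no relation between \<open>\<nu>\<close> and
  the underlying set of \<open>U\<close>, so it applies to \<open>2\<^bsup>\<kappa>\<^esup>\<close> as well; the other half of being Tukey-top is
  automatic, because \<open>U\<close> has at most \<open>2\<^bsup>\<kappa>\<^esup>\<close> members.
\<close>

text \<open>Every bound contains the union \<open>\<Union>T\<close>, so if some bound is small then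
  \<open>\<Union>T\<close> is small, and in that case it is itself a bound.\<close>

lemma unbounded_in_subsets_below_iff:
  "unbounded_in (subsets_below X \<mu>) (\<subseteq>) T \<longleftrightarrow>
     T \<subseteq> subsets_below X \<mu> \<and> \<not> |\<Union>T| <o \<mu>"
proof -
  have "|\<Union>T| <o \<mu>" if "b \<in> subsets_below X \<mu>" "\<forall>S\<in>T. S \<subseteq> b" for b
  proof -
    have "|\<Union>T| \<le>o |b|" using that(2) by (intro card_of_mono1) blast
    then show ?thesis using that(1) by (auto simp: subsets_below_def intro: ordLeq_ordLess_trans)
  qed
  moreover have "\<Union>T \<in> subsets_below X \<mu>" if "T \<subseteq> subsets_below X \<mu>" "|\<Union>T| <o \<mu>"
    using that by (auto simp: subsets_below_def)
  ultimately show ?thesis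
    unfolding unbounded_in_def by (meson Union_upper)
qed

lemma card_of_finite_ordLess_Cinfinite:
  assumes "finite A" "Cinfinite \<mu>"
  shows "|A| <o \<mu>"
  using assms
  by (intro finite_ordLess_infinite)
    (auto simp: cinfinite_def Field_card_of card_of_well_order_on card_order_on_well_order_on)

text \<open>Serves to shrink a large index set to size exactly \<mu>, as \<open>Gal\<close>
  demands.\<close>

lemma ex_subset_card_of_ordIso:
  assumes "Card_order \<mu>" "\<mu> \<le>o |A|"
  obtains I where "I \<subseteq> A" "|I| =o \<mu>"
proof -
  have "|Field \<mu>| \<le>o |A|"
    using assms card_of_Field_ordIso ordIso_ordLeq_trans by blast
  then obtain I where "I \<subseteq> A" "|Field \<mu>| =o |I|"
    by (blast dest: internalize_card_of_ordLeq2[THEN iffD1])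
  have "|I| =o \<mu>"
    using ordIso_symmetric[OF \<open>|Field \<mu>| =o |I|\<close>] card_of_Field_ordIso[OF assms(1)]
    by (rule ordIso_transitive)
  with \<open>I \<subseteq> A\<close> show ?thesis by (rule that)
qed

lemma tukey_le_if_not_Gal:
  assumes \<mu>: "Cinfinite \<mu>" and U: "filter_over X U" "complete_family \<mu> U" and nG: "\<not> Gal U \<mu> \<nu>"
  shows "tukey_le (subsets_below (Field \<nu>) \<mu>) (\<subseteq>) U (\<supseteq>)"
proof -
  obtain A where A: "A ` Field \<nu> \<subseteq> U"
    and noex: "\<not> (\<exists>I. I \<subseteq> Field \<nu> \<and> |I| =o \<mu> \<and> (\<Inter>i\<in>I. A i) \<in> U)"
    using nG unfolding Gal_def not_all not_imp by (elim exE conjE)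
  have no: "(\<Inter>i\<in>I. A i) \<notin> U" if "I \<subseteq> Field \<nu>" "|I| =o \<mu>" for I
    using noex that by blast
  \<comment> \<open>The intersection over the empty set would be the whole type, which may fail to
    lie in \<open>U\<close>; its value relative to \<open>X\<close> is \<open>X\<close>.\<close>
  define g where "g S = (if S = {} then X else \<Inter>i\<in>S. A i)" for S
  have gU: "g S \<in> U" if "S \<in> subsets_below (Field \<nu>) \<mu>" for S
  proof (cases "S = {}")
    case True
    then show ?thesis using U(1) by (simp add: g_def filter_over_def)
  next
    case False
    have "|A ` S| <o \<mu>"
      using that by (intro ordLeq_ordLess_trans[OF card_of_image]) (simp add: subsets_below_def)
    moreover have "A ` S \<subseteq> U" using that A by (auto simp: subsets_below_def)
    ultimately show ?thesis
      using False U(2) by (simp add: g_def complete_family_def)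
  qed
  moreover have "unbounded_in U (\<supseteq>) (g ` T)"
    if T: "unbounded_in (subsets_below (Field \<nu>) \<mu>) (\<subseteq>) T" for T
  proof -
    have sub: "T \<subseteq> subsets_below (Field \<nu>) \<mu>" and "\<not> |\<Union>T| <o \<mu>"
      using T by (auto simp: unbounded_in_subsets_below_iff)
    then have "\<mu> \<le>o |\<Union>T|"
      using \<mu> not_ordLess_iff_ordLeq[OF _ card_of_Well_order] card_order_on_well_order_on by blast
    then obtain I where I: "I \<subseteq> \<Union>T" "|I| =o \<mu>"
      using \<mu> ex_subset_card_of_ordIso by blast
    have I\<nu>: "I \<subseteq> Field \<nu>" using I(1) sub by (auto simp: subsets_below_def)
    \<comment> \<open>A member \<open>j\<close> of \<open>I\<close> places the intersection inside
      \<open>A j\<close>, hence inside \<open>X\<close>, as upward closure of \<open>U\<close>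
      requires.\<close>
    have "I \<noteq> {}"
      using card_of_ordIso_finite_Field[OF _ ordIso_symmetric[OF I(2)]] \<mu>
      by (auto simp: cinfinite_def)
    have UX: "B \<subseteq> X" if "B \<in> U" for B using U(1) that by (auto simp: filter_over_def)
    have up: "C \<in> U" if "B \<in> U" "B \<subseteq> C" "C \<subseteq> X" for B C
      using U(1) that by (simp add: filter_over_def)
    from \<open>I \<noteq> {}\<close> obtain j where "j \<in> I" by blast
    then have "A j \<subseteq> X" using I\<nu> A by (auto intro!: UX)
    \<comment> \<open>Each \<open>i\<close> in \<open>I\<close> lies in some \<open>S\<close> in
      \<open>T\<close>, so a bound \<open>b\<close> satisfies
      \<open>b \<subseteq> g S \<subseteq> A i\<close>.\<close>
    have False if b: "b \<in> U" "\<forall>x\<in>g ` T. b \<subseteq> x" for b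
    proof -
      have "b \<subseteq> (\<Inter>i\<in>I. A i)"
      proof (rule INT_greatest)
        fix i
        assume "i \<in> I"
        then obtain S where S: "S \<in> T" "i \<in> S" using I(1) by blast
        then have "g S \<subseteq> A i" by (auto simp: g_def)
        then show "b \<subseteq> A i" using b(2) S(1) by blast
      qed
      moreover have "(\<Inter>i\<in>I. A i) \<subseteq> X"
        using INT_lower[OF \<open>j \<in> I\<close>] \<open>A j \<subseteq> X\<close> by (rule order_trans)
      ultimately have "(\<Inter>i\<in>I. A i) \<in> U"
        using up[OF b(1)] by simp
      then show False using no[OF I\<nu> I(2)] by contradiction
    qed
    moreover have "g ` T \<subseteq> U" using gU sub by blast
    ultimately show ?thesis unfolding unbounded_in_def by blast
  qed
  ultimately show ?thesis
    unfolding tukey_le_def by (intro exI[of _ g]) (simp add: image_subset_iff)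
qed

lemma not_Gal_if_tukey_le:
  assumes \<mu>: "Cinfinite \<mu>" and \<nu>: "Card_order \<nu>" "\<mu> \<le>o \<nu>" and U: "complete_family \<mu> U"
    and le: "tukey_le (subsets_below (Field \<nu>) \<mu>) (\<subseteq>) U (\<supseteq>)"
  shows "\<not> Gal U \<mu> \<nu>"
proof -
  have W: "Well_order \<mu>" using \<mu> by (auto simp: card_order_on_well_order_on)
  have inf: "\<not> finite (Field \<mu>)" using \<mu> by (simp add: cinfinite_def)
  obtain g where gU: "g ` subsets_below (Field \<nu>) \<mu> \<subseteq> U"
    and g: "\<And>S. unbounded_in (subsets_below (Field \<nu>) \<mu>) (\<subseteq>) S \<Longrightarrow> unbounded_in U (\<supseteq>) (g ` S)"
    using le unfolding tukey_le_def by blast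
  define A where "A i = g {i}" for i
  have sing: "{i} \<in> subsets_below (Field \<nu>) \<mu>" if "i \<in> Field \<nu>" for i
    using that \<mu> by (simp add: subsets_below_def card_of_finite_ordLess_Cinfinite)
  have AU: "A ` Field \<nu> \<subseteq> U" using gU sing by (auto simp: A_def)
  \<comment> \<open>The intersection would bound all \<open>g {i}\<close> with \<open>i\<close> in
    \<open>I\<close>, whereas the singletons themselves have union \<open>I\<close> and are
    unbounded once \<open>I\<close> is not small.\<close>
  have small: "|I| <o \<mu>" if I: "I \<subseteq> Field \<nu>" and inter: "(\<Inter>i\<in>I. A i) \<in> U" for I
  proof (rule ccontr)
    assume "\<not> |I| <o \<mu>"
    then have "unbounded_in (subsets_below (Field \<nu>) \<mu>) (\<subseteq>) ((\<lambda>i. {i}) ` I)"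
      using I sing by (auto simp: unbounded_in_subsets_below_iff)
    from g[OF this] have "unbounded_in U (\<supseteq>) (A ` I)"
      by (simp add: image_image A_def)
    then show False using inter by (auto simp: unbounded_in_def)
  qed
  \<comment> \<open>On a nonempty fibre \<open>A\<close> is constant, so the intersection over it is
    \<open>B\<close>, a member of \<open>U\<close>.\<close>
  have fibre: "|{i \<in> Field \<nu>. A i = B}| <o \<mu>" for B
  proof (cases "B \<in> A ` Field \<nu>")
    case True
    then have "(\<Inter>i\<in>{i \<in> Field \<nu>. A i = B}. A i) = B" by auto
    then show ?thesis using small[of "{i \<in> Field \<nu>. A i = B}"] True AU by auto
  next
    case False
    then have "{i \<in> Field \<nu>. A i = B} = {}" by auto
    then show ?thesis using \<mu> by (simp only: card_of_finite_ordLess_Cinfinite finite.emptyI)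
  qed
  let ?R = "A ` Field \<nu>"
  have \<nu>F: "\<nu> =o |Field \<nu>|" using \<nu>(1) by (meson card_of_Field_ordIso ordIso_symmetric)
  \<comment> \<open>With a smaller range, completeness would put the intersection of the whole
    family into \<open>U\<close>, and \<open>small\<close> for \<open>I = Field \<nu>\<close> would
    give \<open>\<nu> <o \<mu>\<close>.\<close>
  have R\<mu>: "\<mu> \<le>o |?R|"
  proof (rule ccontr)
    assume "\<not> \<mu> \<le>o |?R|"
    then have "|?R| <o \<mu>" using not_ordLeq_iff_ordLess[OF card_of_Well_order W] by blast
    moreover have "?R \<noteq> {}"
      using inf card_of_mono2[OF \<nu>(2)] card_of_ordLeq_infinite by fastforce
    ultimately have "\<Inter>?R \<in> U" using U AU unfolding complete_family_def by blast
    then have "|Field \<nu>| <o \<mu>" using small by blast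
    then have "\<nu> <o \<mu>" using \<nu>F ordIso_ordLess_trans by blast
    then show False using \<nu>(2) not_ordLess_ordLeq by blast
  qed
  have Rinf: "\<not> finite ?R"
    using inf card_of_mono2[OF R\<mu>] card_of_ordLeq_infinite unfolding Field_card_of by blast
  \<comment> \<open>\<open>Field \<nu>\<close> is the union of the fibres: there are
    \<open>|?R|\<close> of them, each of size below \<mu> and so at most
    \<open>|?R|\<close>.\<close>
  have "|\<Union>B\<in>?R. {i \<in> Field \<nu>. A i = B}| \<le>o |?R|"
  proof (rule card_of_UNION_ordLeq_infinite[OF Rinf])
    show "|?R| \<le>o |?R|" by (rule card_of_mono1[OF subset_refl])
    show "\<forall>B\<in>?R. |{i \<in> Field \<nu>. A i = B}| \<le>o |?R|"
      using fibre R\<mu> by (meson ordLess_imp_ordLeq ordLeq_transitive)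
  qed
  moreover have "(\<Union>B\<in>?R. {i \<in> Field \<nu>. A i = B}) = Field \<nu>" by auto
  ultimately have "|Field \<nu>| \<le>o |?R|" by simp
  then obtain f where f: "inj_on f (Field \<nu>)" "f ` Field \<nu> \<subseteq> ?R"
    by (metis card_of_ordLeq)
  define r where "r i = inv_into (Field \<nu>) A (f i)" for i
  have r: "r i \<in> Field \<nu>" "A (r i) = f i" if "i \<in> Field \<nu>" for i
    using that f(2) by (auto simp: r_def inv_into_into f_inv_into_f image_subset_iff)
  have r_inj: "inj_on r (Field \<nu>)"
    using f(1) r(2) by (metis inj_on_def)
  show ?thesis
  proof
    assume "Gal U \<mu> \<nu>"
    then obtain I where I: "I \<subseteq> Field \<nu>" "|I| =o \<mu>" "(\<Inter>i\<in>I. f i) \<in> U"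
      using f AU unfolding Gal_def by (meson subset_trans)
    have "(\<Inter>i\<in>r ` I. A i) = (\<Inter>i\<in>I. f i)"
      using r(2) I(1) by (auto simp: subset_iff)
    moreover have "r ` I \<subseteq> Field \<nu>" using r(1) I(1) by auto
    ultimately have "|r ` I| <o \<mu>" using small I(3) by simp
    moreover have "|r ` I| =o |I|"
      using inj_on_subset[OF r_inj I(1)] card_of_ordIso inj_on_imp_bij_betw ordIso_symmetric by blast
    ultimately show False
      using I(2) by (meson not_ordLess_ordIso ordIso_transitive)
  qed
qed

text \<open>By completeness an unbounded subset of \<open>U\<close> has size at least \<mu>. Coding
  members of \<open>U\<close> injectively as singletons preserves this size in the union.\<close>

lemma tukey_le_subsets_below_if_complete:
  assumes \<mu>: "Cinfinite \<mu>" and U: "U \<noteq> {}" "complete_family \<mu> U" and le: "|U| \<le>o |Y|"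
  shows "tukey_le U (\<supseteq>) (subsets_below Y \<mu>) (\<subseteq>)"
proof -
  obtain h where h: "inj_on h U" "h ` U \<subseteq> Y"
    using le by (metis card_of_ordLeq)
  have sing: "{h B} \<in> subsets_below Y \<mu>" if "B \<in> U" for B
    using that h(2) \<mu> by (auto simp: subsets_below_def card_of_finite_ordLess_Cinfinite)
  have "unbounded_in (subsets_below Y \<mu>) (\<subseteq>) ((\<lambda>B. {h B}) ` S)" if S: "unbounded_in U (\<supseteq>) S" for S
  proof -
    have SU: "S \<subseteq> U" and nb: "\<And>b. b \<in> U \<Longrightarrow> \<exists>B\<in>S. \<not> b \<subseteq> B"
      using S by (auto simp: unbounded_in_def)
    \<comment> \<open>Any member of \<open>U\<close> bounds the empty set; completeness speaks of
      nonempty families only.\<close>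
    have "S \<noteq> {}" using nb U(1) by blast
    have "\<not> |S| <o \<mu>"
    proof
      assume "|S| <o \<mu>"
      then have "\<Inter>S \<in> U" using U(2) SU \<open>S \<noteq> {}\<close> unfolding complete_family_def by blast
      then show False using nb by (meson Inter_lower)
    qed
    moreover have "|S| =o |h ` S|"
      using inj_on_subset[OF h(1) SU] card_of_ordIso inj_on_imp_bij_betw by blast
    ultimately have "\<not> |h ` S| <o \<mu>" using ordIso_ordLess_trans by blast
    moreover have "\<Union>((\<lambda>B. {h B}) ` S) = h ` S" by auto
    ultimately show ?thesis
      using sing SU by (auto simp: unbounded_in_subsets_below_iff)
  qed
  then show ?thesis
    unfolding tukey_le_def using sing by (intro exI[of _ "\<lambda>B. {h B}"]) auto
qed

theorem theorem2p4:
  "(\<forall>(\<mu> :: 'l rel) (\<kappa> :: 'k rel) U.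
      Cinfinite \<mu> \<and> Card_order \<kappa> \<and> \<mu> \<le>o \<kappa> \<and>
      filter_over (Field \<kappa>) U \<and> complete_family \<mu> U \<longrightarrow>
      (tukey_le (subsets_below (Field \<kappa>) \<mu>) (\<subseteq>) U (\<supseteq>) \<longleftrightarrow> \<not> Gal U \<mu> \<kappa>)) \<and>
   (\<forall>\<kappa> :: 'k rel. measurable_cardinal \<kappa> \<longrightarrow>
      (\<forall>U. ultrafilter_over (Field \<kappa>) U \<and> uniform_over \<kappa> U \<and> complete_family \<kappa> U \<longrightarrow>
         (tukey_top \<kappa> U \<longleftrightarrow> \<not> Gal U \<kappa> (ctwo ^c \<kappa>))))"
proof (intro conjI allI impI)
  fix \<mu> :: "'l rel" and \<kappa> :: "'k rel" and U
  assume "Cinfinite \<mu> \<and> Card_order \<kappa> \<and> \<mu> \<le>o \<kappa> \<and>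
      filter_over (Field \<kappa>) U \<and> complete_family \<mu> U"
  then show "tukey_le (subsets_below (Field \<kappa>) \<mu>) (\<subseteq>) U (\<supseteq>) \<longleftrightarrow> \<not> Gal U \<mu> \<kappa>"
    using tukey_le_if_not_Gal not_Gal_if_tukey_le by metis
next
  fix \<kappa> :: "'k rel" and U
  assume \<kappa>m: "measurable_cardinal \<kappa>"
    and "ultrafilter_over (Field \<kappa>) U \<and> uniform_over \<kappa> U \<and> complete_family \<kappa> U"
  then have U: "filter_over (Field \<kappa>) U" "complete_family \<kappa> U"
    by (auto simp: ultrafilter_over_def)
  have C: "Card_order \<kappa>" and "natLeq <o \<kappa>"
    using \<kappa>m by (auto simp: measurable_cardinal_def)
  then have \<kappa>: "Cinfinite \<kappa>"
    using cinfinite_mono natLeq_cinfinite ordLess_imp_ordLeq by blast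
  have C2: "Card_order (ctwo ^c \<kappa>)" by (rule Card_order_cexp)
  have "|U| \<le>o |Pow (Field \<kappa>)|"
    using U(1) by (auto simp: filter_over_def intro: card_of_mono1)
  also have "|Pow (Field \<kappa>)| =o ctwo ^c \<kappa>"
    unfolding ctwo_def cexp_def Field_card_of by (rule card_of_Pow_Func)
  also have "ctwo ^c \<kappa> =o |Field (ctwo ^c \<kappa>)|"
    using C2 card_of_Field_ordIso ordIso_symmetric by blast
  finally have "|U| \<le>o |Field (ctwo ^c \<kappa>)|" .
  moreover have "U \<noteq> {}" using U(1) by (auto simp: filter_over_def)
  ultimately have "tukey_le U (\<supseteq>) (subsets_below (Field (ctwo ^c \<kappa>)) \<kappa>) (\<subseteq>)"
    using tukey_le_subsets_below_if_complete[OF \<kappa> _ U(2)] by blast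
  moreover have "\<kappa> \<le>o ctwo ^c \<kappa>"
    using ordLess_ctwo_cexp[OF C] ordLess_imp_ordLeq by blast
  \<comment> \<open>One reduction now holds outright, so \<open>tukey_top\<close> amounts to the
    other one, which the two Galvin lemmas settle with \<nu> taken as
    \<open>ctwo ^c \<kappa>\<close>.\<close>
  ultimately show "tukey_top \<kappa> U \<longleftrightarrow> \<not> Gal U \<kappa> (ctwo ^c \<kappa>)"
    unfolding tukey_top_def tukey_equiv_def
    using tukey_le_if_not_Gal[OF \<kappa> U] not_Gal_if_tukey_le[OF \<kappa> C2 _ U(2)] by blast
qed

end
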